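(* Let $(a,b)\in[0,1]^2$ and let $c\in[0,d^*(a,b)]$, where $d^*(a,b)=\min\{a,b,1-a,1-b,|b-a|\}$. Then there exist bivariate copulas $\underline{C}$ and $\overline{C}$ satisfying $\underline{C}(a,b)-\underline{C}(b,a)=c$ and $\overline{C}(a,b)-\overline{C}(b,a)=c$, such that for every bivariate copula $C$ satisfying $C(a,b)-C(b,a)=c$ we have $\underline{C}\leqslant C\leqslant\overline{C}$, i.e. $\underline{C}(u,v)\leqslant C(u,v)\leqslant\overline{C}(u,v)$ for all $(u,v)\in[0,1]^2$.
   Context: A bivariate copula is a function $C:[0,1]^2\to[0,1]$ that is the restriction to $[0,1]^2$ of a bivariate distribution function with uniform margins on $[0,1]$: $C(u,0)=C(0,v)=0$, $C(u,1)=u$, $C(1,v)=v$, and $C(u_2,v_2)-C(u_1,v_2)-C(u_2,v_1)+C(u_1,v_1)\geqslant 0$ for $u_1\leqslant u_2$, $v_1\leqslant v_2$. The quantity $d^*(a,b)=\min\{a,b,1-a,1-b,|b-a|\}$ equals (by a known result of Klement and Mesiar) the maximum of $|C(a,b)-C(b,a)|$ over all bivariate copulas $C$. *)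

theory Defs
  imports Complex_Main
begin

(* Functions on the unit square are total functions on the reals; their values
   outside [0,1] x [0,1] are unconstrained and irrelevant. *)
definition copula :: "(real \<Rightarrow> real \<Rightarrow> real) \<Rightarrow> bool" where
  "copula C \<longleftrightarrow>
     (\<forall>u\<in>{0..1}. \<forall>v\<in>{0..1}. C u v \<in> {0..1}) \<and>
     (\<forall>u\<in>{0..1}. C u 0 = 0 \<and> C u 1 = u) \<and>
     (\<forall>v\<in>{0..1}. C 0 v = 0 \<and> C 1 v = v) \<and>
     (\<forall>u1\<in>{0..1}. \<forall>u2\<in>{0..1}. \<forall>v1\<in>{0..1}. \<forall>v2\<in>{0..1}.
        u1 \<le> u2 \<longrightarrow> v1 \<le> v2 \<longrightarrow> C u2 v2 - C u1 v2 - C u2 v1 + C u1 v1 \<ge> 0)"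

definition d_star :: "real \<Rightarrow> real \<Rightarrow> real" where
  "d_star a b = Min {a, b, 1 - a, 1 - b, \<bar>b - a\<bar>}"

end

theory Submission
  imports Defs
begin

text \<open>
  Since \<open>W \<le> C \<le> M\<close> for \<open>W(u,v) = max 0 (u+v-1)\<close> and \<open>M(u,v) = min u v\<close>, the constraint
  forces \<open>C(a,b) \<ge> W(a,b) + c\<close> and \<open>C(b,a) \<le> M(a,b) - c\<close>. Monotonicity and the 1-Lipschitz
  property of copulas spread these two inequalities over the square. The resulting bounds are the
  extremal copulas with a prescribed value at one point, and \<open>c \<le> \<bar>b - a\<bar>\<close> keeps their values
  at the mirrored point at \<open>W(a,b)\<close> and \<open>M(a,b)\<close>.
\<close>

text \<open>For \<open>t\<close> between \<open>W(a,b)\<close> and \<open>M(a,b)\<close>, both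
  functions take the value \<open>t\<close> at \<open>(a, b)\<close>. The truncated terms are the
  most that the value can change on the way to \<open>(u, v)\<close>.\<close>

definition upper_copula :: "real \<Rightarrow> real \<Rightarrow> real \<Rightarrow> real \<Rightarrow> real \<Rightarrow> real" where
  "upper_copula a b t u v = min (min u v) (t + max 0 (u - a) + max 0 (v - b))"

definition lower_copula :: "real \<Rightarrow> real \<Rightarrow> real \<Rightarrow> real \<Rightarrow> real \<Rightarrow> real" where
  "lower_copula a b t u v = max (max 0 (u + v - 1)) (t - max 0 (a - u) - max 0 (b - v))"

lemma min_2_increasing:
  fixes x1 x2 y1 y2 :: real
  assumes "x1 \<le> x2" "y1 \<le> y2"
  shows "min x2 y2 - min x1 y2 - min x2 y1 + min x1 y1 \<ge> 0"
  using assms by (auto simp: min_def)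

text \<open>The volume \<open>V\<close> is additive when a rectangle is cut along
  \<open>u = a\<close> or \<open>v = b\<close>, so checking each quadrant at \<open>(a, b)\<close>
  suffices.\<close>

lemma two_increasing_glue:
  fixes F :: "real \<Rightarrow> real \<Rightarrow> real"
  defines "V \<equiv> \<lambda>u1 u2 v1 v2. F u2 v2 - F u1 v2 - F u2 v1 + F u1 v1"
  assumes ll: "\<And>u1 u2 v1 v2. u1 \<le> u2 \<Longrightarrow> u2 \<le> a \<Longrightarrow> v1 \<le> v2 \<Longrightarrow> v2 \<le> b \<Longrightarrow> V u1 u2 v1 v2 \<ge> 0"
    and lr: "\<And>u1 u2 v1 v2. u1 \<le> u2 \<Longrightarrow> u2 \<le> a \<Longrightarrow> v1 \<le> v2 \<Longrightarrow> b \<le> v1 \<Longrightarrow> V u1 u2 v1 v2 \<ge> 0"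
    and rl: "\<And>u1 u2 v1 v2. u1 \<le> u2 \<Longrightarrow> a \<le> u1 \<Longrightarrow> v1 \<le> v2 \<Longrightarrow> v2 \<le> b \<Longrightarrow> V u1 u2 v1 v2 \<ge> 0"
    and rr: "\<And>u1 u2 v1 v2. u1 \<le> u2 \<Longrightarrow> a \<le> u1 \<Longrightarrow> v1 \<le> v2 \<Longrightarrow> b \<le> v1 \<Longrightarrow> V u1 u2 v1 v2 \<ge> 0"
    and "u1 \<le> u2" "v1 \<le> v2"
  shows "V u1 u2 v1 v2 \<ge> 0"
proof -
  have split_u: "V u1 u2 v1 v2 = V u1 w v1 v2 + V w u2 v1 v2" for u1 u2 v1 v2 w
    by (simp add: V_def)
  have split_v: "V u1 u2 v1 v2 = V u1 u2 v1 w + V u1 u2 w v2" for u1 u2 v1 v2 w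
    by (simp add: V_def)
  have left: "V u1 u2 v1 v2 \<ge> 0" if "u1 \<le> u2" "u2 \<le> a" "v1 \<le> v2" for u1 u2 v1 v2
    using that ll[of u1 u2 v1 v2] lr[of u1 u2 v1 v2] ll[of u1 u2 v1 b] lr[of u1 u2 b v2]
      split_v[of u1 u2 v1 v2 b] by linarith
  have right: "V u1 u2 v1 v2 \<ge> 0" if "u1 \<le> u2" "a \<le> u1" "v1 \<le> v2" for u1 u2 v1 v2
    using that rl[of u1 u2 v1 v2] rr[of u1 u2 v1 v2] rl[of u1 u2 v1 b] rr[of u1 u2 b v2]
      split_v[of u1 u2 v1 v2 b] by linarith
  show ?thesis
    using \<open>u1 \<le> u2\<close> \<open>v1 \<le> v2\<close> left[of u1 u2 v1 v2] right[of u1 u2 v1 v2]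
      left[of u1 a v1 v2] right[of a u2 v1 v2] split_u[of u1 u2 v1 v2 a] by linarith
qed

text \<open>On each quadrant at \<open>(a, b)\<close> the truncations resolve, leaving a
  \<open>min\<close> of a monotone function of \<open>u\<close> and one of \<open>v\<close>, up to a
  sum \<open>u + v\<close> that has zero volume.\<close>

lemma upper_copula_2_increasing:
  assumes "t \<le> a" "t \<le> b" "u1 \<le> u2" "v1 \<le> v2"
  shows "upper_copula a b t u2 v2 - upper_copula a b t u1 v2
    - upper_copula a b t u2 v1 + upper_copula a b t u1 v1 \<ge> 0"
proof (rule two_increasing_glue[where a = a and b = b])
  fix u1 u2 v1 v2 :: real
  assume le: "u1 \<le> u2" "v1 \<le> v2"
  let ?V = "upper_copula a b t u2 v2 - upper_copula a b t u1 v2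
    - upper_copula a b t u2 v1 + upper_copula a b t u1 v1"
  show "?V \<ge> 0" if "u2 \<le> a" "v2 \<le> b"
  proof -
    have "upper_copula a b t u v = min u (min v t)" if "u \<le> a" "v \<le> b" for u v
      using that unfolding upper_copula_def by linarith
    then show ?thesis
      using that le min_2_increasing[of u1 u2 "min v1 t" "min v2 t"] by simp
  qed
  show "?V \<ge> 0" if "u2 \<le> a" "b \<le> v1"
  proof -
    \<comment> \<open>Here \<open>t <= b\<close> makes \<open>t + v - b <= v\<close>, so the term
      \<open>v\<close> drops out of the minimum.\<close>
    have "upper_copula a b t u v = min u (t + v - b)" if "u \<le> a" "b \<le> v" for u v
      using that assms(1,2) unfolding upper_copula_def by linarith
    then show ?thesis
      using that le min_2_increasing[of u1 u2 "t + v1 - b" "t + v2 - b"] by simp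
  qed
  show "?V \<ge> 0" if "a \<le> u1" "v2 \<le> b"
  proof -
    have "upper_copula a b t u v = min (t + u - a) v" if "a \<le> u" "v \<le> b" for u v
      using that assms(1,2) unfolding upper_copula_def by linarith
    then show ?thesis
      using that le min_2_increasing[of "t + u1 - a" "t + u2 - a" v1 v2] by simp
  qed
  show "?V \<ge> 0" if "a \<le> u1" "b \<le> v1"
  proof -
    \<comment> \<open>Factoring out \<open>u + v\<close> separates the variables. Both arguments of
      the remaining \<open>min\<close> are decreasing; the two order reversals cancel in the
      volume.\<close>
    have "upper_copula a b t u v = u + v + min (- u) (min (- v) (t - a - b))"
      if "a \<le> u" "b \<le> v" for u v
      using that unfolding upper_copula_def by linarith
    then show ?thesis
      using that le min_2_increasing[of "- u2" "- u1" "min (- v2) (t - a - b)" "min (- v1) (t - a - b)"]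
      by simp
  qed
qed (use assms in auto)

lemma copula_upper_copula:
  assumes "a \<in> {0..1}" "b \<in> {0..1}" "0 \<le> t" "a + b - 1 \<le> t" "t \<le> a" "t \<le> b"
  shows "copula (upper_copula a b t)"
  unfolding copula_def
proof (intro conjI ballI impI upper_copula_2_increasing)
qed (use assms in \<open>auto simp: upper_copula_def\<close>)

lemma copula_rect:
  assumes "copula C" "u1 \<in> {0..1}" "u2 \<in> {0..1}" "v1 \<in> {0..1}" "v2 \<in> {0..1}"
    "u1 \<le> u2" "v1 \<le> v2"
  shows "C u2 v2 - C u1 v2 - C u2 v1 + C u1 v1 \<ge> 0"
  using assms unfolding copula_def by blast

lemma copula_margins:
  assumes "copula C" "u \<in> {0..1}"
  shows "C u 0 = 0" "C u 1 = u" "C 0 u = 0" "C 1 u = u"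
  using assms unfolding copula_def by blast+

lemma copula_range:
  assumes "copula C" "u \<in> {0..1}" "v \<in> {0..1}"
  shows "C u v \<in> {0..1}"
  using assms unfolding copula_def by blast

text \<open>Reflecting a copula in its second argument exchanges the two extremal families.\<close>

lemma copula_reflect:
  assumes "copula C"
  shows "copula (\<lambda>u v. u - C u (1 - v))"
proof -
  note rect = copula_rect[OF assms] and margins = copula_margins[OF assms]
  have le: "C u v \<le> u" if "u \<in> {0..1}" "v \<in> {0..1}" for u v
    using rect[of 0 u v 1] margins[of u] margins[of v] margins[of 1] that by auto
  show ?thesis
    unfolding copula_def
  proof (intro conjI ballI impI)
    fix u1 u2 v1 v2 :: real
    assume "u1 \<in> {0..1}" "u2 \<in> {0..1}" "v1 \<in> {0..1}" "v2 \<in> {0..1}" "u1 \<le> u2" "v1 \<le> v2"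
    then show "u2 - C u2 (1 - v2) - (u1 - C u1 (1 - v2)) - (u2 - C u2 (1 - v1))
        + (u1 - C u1 (1 - v1)) \<ge> 0"
      using rect[of u1 u2 "1 - v2" "1 - v1"] by simp
  next
    fix u v :: real
    assume "u \<in> {0..1}" "v \<in> {0..1}"
    then show "u - C u (1 - v) \<in> {0..1}"
      using le[of u "1 - v"] copula_range[OF assms, of u "1 - v"] by simp
  qed (use margins in simp_all)
qed

lemma copula_lower_copula:
  assumes "a \<in> {0..1}" "b \<in> {0..1}" "0 \<le> t" "a + b - 1 \<le> t" "t \<le> a" "t \<le> b"
  shows "copula (lower_copula a b t)"
proof -
  \<comment> \<open>Reflection turns the value \<open>t\<close> at \<open>(a, b)\<close> into
    \<open>a - t\<close> at \<open>(a, 1 - b)\<close>, and the bounds on \<open>t\<close> become the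
    bounds required there.\<close>
  have "lower_copula a b t = (\<lambda>u v. u - upper_copula a (1 - b) (a - t) u (1 - v))"
    unfolding lower_copula_def upper_copula_def by (intro ext) linarith
  moreover have "copula (upper_copula a (1 - b) (a - t))"
    using assms by (intro copula_upper_copula) auto
  ultimately show ?thesis
    using copula_reflect by simp
qed

context
  fixes C :: "real \<Rightarrow> real \<Rightarrow> real"
  assumes C: "copula C"
begin

text \<open>The rectangles over \<open>[u1, u2]\<close> below and above height \<open>v\<close> have
  nonnegative volume. By the margins, the first yields monotonicity and the second the Lipschitz
  bound.\<close>

lemma copula_increment_1:
  assumes "u1 \<in> {0..1}" "u2 \<in> {0..1}" "v \<in> {0..1}" "u1 \<le> u2"
  shows "C u1 v \<le> C u2 v" "C u2 v - C u1 v \<le> u2 - u1"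
proof -
  have "C u2 v - C u1 v - C u2 0 + C u1 0 \<ge> 0" "C u2 1 - C u1 1 - C u2 v + C u1 v \<ge> 0"
    using assms copula_rect[OF C, of u1 u2 0 v] copula_rect[OF C, of u1 u2 v 1] by auto
  moreover have "C u1 0 = 0" "C u2 0 = 0" "C u1 1 = u1" "C u2 1 = u2"
    using C assms by (simp_all add: copula_margins)
  ultimately show "C u1 v \<le> C u2 v" "C u2 v - C u1 v \<le> u2 - u1"
    by linarith+
qed

lemma copula_increment_2:
  assumes "v1 \<in> {0..1}" "v2 \<in> {0..1}" "u \<in> {0..1}" "v1 \<le> v2"
  shows "C u v1 \<le> C u v2" "C u v2 - C u v1 \<le> v2 - v1"
proof -
  have "C u v2 - C 0 v2 - C u v1 + C 0 v1 \<ge> 0" "C 1 v2 - C u v2 - C 1 v1 + C u v1 \<ge> 0"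
    using assms copula_rect[OF C, of 0 u v1 v2] copula_rect[OF C, of u 1 v1 v2] by auto
  moreover have "C 0 v1 = 0" "C 0 v2 = 0" "C 1 v1 = v1" "C 1 v2 = v2"
    using C assms by (simp_all add: copula_margins)
  ultimately show "C u v1 \<le> C u v2" "C u v2 - C u v1 \<le> v2 - v1"
    by linarith+
qed

lemma copula_frechet:
  assumes "u \<in> {0..1}" "v \<in> {0..1}"
  shows "max 0 (u + v - 1) \<le> C u v" "C u v \<le> min u v"
proof -
  have "C u v \<ge> 0" "C u 0 = 0" "C u 1 = u" "C 0 v = 0" "C 1 v = v"
    using copula_range[OF C, of u v] C assms by (simp_all add: copula_margins)
  then show "max 0 (u + v - 1) \<le> C u v" "C u v \<le> min u v"
    using assms copula_increment_1[of 0 u v] copula_increment_2[of 0 v u]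
      copula_increment_2[of v 1 u] by auto
qed

text \<open>Change one coordinate at a time: an increase costs at most its length, and a decrease
  costs nothing by monotonicity.\<close>

lemma copula_diff_le:
  assumes "u \<in> {0..1}" "v \<in> {0..1}" "u' \<in> {0..1}" "v' \<in> {0..1}"
  shows "C u v - C u' v' \<le> max 0 (u - u') + max 0 (v - v')"
proof -
  have "C u v - C u' v \<le> max 0 (u - u')"
    using copula_increment_1(2)[of u' u v] copula_increment_1(1)[of u u' v] assms by linarith
  moreover have "C u' v - C u' v' \<le> max 0 (v - v')"
    using copula_increment_2(2)[of v' v u'] copula_increment_2(1)[of v v' u'] assms by linarith
  ultimately show ?thesis by linarith
qed

lemma lower_copula_le:
  assumes "a \<in> {0..1}" "b \<in> {0..1}" "u \<in> {0..1}" "v \<in> {0..1}" "t \<le> C a b"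
  shows "lower_copula a b t u v \<le> C u v"
  using copula_diff_le[of a b u v] copula_frechet(1)[of u v] assms
  unfolding lower_copula_def by linarith

lemma le_upper_copula:
  assumes "a \<in> {0..1}" "b \<in> {0..1}" "u \<in> {0..1}" "v \<in> {0..1}" "C a b \<le> t"
  shows "C u v \<le> upper_copula a b t u v"
  using copula_diff_le[of u v a b] copula_frechet(2)[of u v] assms
  unfolding upper_copula_def by linarith

end

theorem theorem2:
  fixes a b c :: real
  assumes "a \<in> {0..1}" and "b \<in> {0..1}" and "c \<in> {0..d_star a b}"
  shows "\<exists>C_low C_up :: real \<Rightarrow> real \<Rightarrow> real.
    copula C_low \<and> C_low a b - C_low b a = c \<and>
    copula C_up \<and> C_up a b - C_up b a = c \<and>
    (\<forall>C. copula C \<and> C a b - C b a = c \<longrightarrow>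
      (\<forall>u\<in>{0..1}. \<forall>v\<in>{0..1}. C_low u v \<le> C u v \<and> C u v \<le> C_up u v))"
proof (intro exI conjI allI impI ballI)
  let ?s = "max 0 (a + b - 1) + c" and ?t = "min a b - c"
  have c: "0 \<le> c" "c \<le> a" "c \<le> b" "c \<le> 1 - a" "c \<le> 1 - b" "c \<le> \<bar>b - a\<bar>"
    using assms(3) by (auto simp: d_star_def)
  show "copula (lower_copula a b ?s)"
    by (rule copula_lower_copula) (use assms(1,2) c in auto)
  \<comment> \<open>The anchor is \<open>(b, a)\<close>, since it is \<open>C b a\<close> that the
    constraint bounds from above. The bounds of \<open>c\<close> by \<open>a\<close>,
    \<open>b\<close>, \<open>1 - a\<close> and \<open>1 - b\<close> keep \<open>?t\<close>
    admissible.\<close>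
  show "copula (upper_copula b a ?t)"
    by (rule copula_upper_copula) (use assms(1,2) c in auto)
  \<comment> \<open>At \<open>(b, a)\<close> the truncated terms add up to the distance of
    \<open>a\<close> and \<open>b\<close>, which is at least \<open>c\<close>, so the maximum there
    falls back to \<open>max 0 (a + b - 1)\<close>.\<close>
  show "lower_copula a b ?s a b - lower_copula a b ?s b a = c"
    using c unfolding lower_copula_def by (simp add: add.commute)
  show "upper_copula b a ?t a b - upper_copula b a ?t b a = c"
    using c unfolding upper_copula_def by (simp add: min.commute)
  fix C :: "real \<Rightarrow> real \<Rightarrow> real" and u v :: real
  assume "copula C \<and> C a b - C b a = c" and uv: "u \<in> {0..1}" "v \<in> {0..1}"
  then have C: "copula C" and diff: "C a b - C b a = c"
    by auto
  have "?s \<le> C a b"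
    using copula_frechet(1)[OF C, of b a] assms(1,2) diff by linarith
  then show "lower_copula a b ?s u v \<le> C u v"
    using lower_copula_le[OF C] assms(1,2) uv by blast
  have "C b a \<le> ?t"
    using copula_frechet(2)[OF C, of a b] assms(1,2) diff by linarith
  then show "C u v \<le> upper_copula b a ?t u v"
    using le_upper_copula[OF C] assms(1,2) uv by blast
qed

end
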